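(* Let $k\ge3$ be an integer. There exists a deterministic online algorithm for the $k$-Canadian Traveller Problem with predictions, knowing $k$, such that $ALG\le(2k-1)OPT$ on every instance whose prediction error is at most $1$.
   Context: $k$-Canadian Traveller Problem ($k$-CTP) with predictions: an instance consists of a connected undirected graph $G=(V,E)$, a source $s$, a destination $t$, a nonnegative cost function $c:E\to\mathbb{R}^+$, an unknown set $B\subseteq E$ of blocked edges with $|B|\le k$ such that $G-B$ contains an $s$-$t$ path, and a predicted set $B_p\subseteq E$ of blocked edges with $|B_p|\le k$. The traveller knows $G,c,s,t,k,B_p$ in advance, starts at $s$, and learns whether an edge is blocked only upon reaching one of its endpoints; blocked edges cannot be traversed. $ALG$ is the total cost travelled, $OPT$ the cost of a shortest $s$-$t$ path in $G-B$. The prediction error is $|B\triangle B_p|$. *)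

theory Defs
  imports Complex_Main
begin

definition simple_graph :: "'v set \<Rightarrow> 'v set set \<Rightarrow> bool" where
  "simple_graph V E \<longleftrightarrow> finite V \<and> (\<forall>e\<in>E. e \<subseteq> V \<and> card e = 2)"

definition walk :: "'v set set \<Rightarrow> 'v \<Rightarrow> 'v list \<Rightarrow> 'v \<Rightarrow> bool" where
  "walk F u w v \<longleftrightarrow>
     w \<noteq> [] \<and> hd w = u \<and> last w = v \<and> successively (\<lambda>x y. {x, y} \<in> F) w"

definition is_path :: "'v set set \<Rightarrow> 'v \<Rightarrow> 'v list \<Rightarrow> 'v \<Rightarrow> bool" where
  "is_path F u p v \<longleftrightarrow> walk F u p v \<and> distinct p"

definition connected_graph :: "'v set \<Rightarrow> 'v set set \<Rightarrow> bool" where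
  "connected_graph V E \<longleftrightarrow> V \<noteq> {} \<and> (\<forall>u\<in>V. \<forall>v\<in>V. \<exists>p. is_path E u p v)"

text \<open>Repeated traversals of an edge are paid for each time.\<close>

definition walk_cost :: "('v set \<Rightarrow> real) \<Rightarrow> 'v list \<Rightarrow> real" where
  "walk_cost c w = sum_list (map2 (\<lambda>x y. c {x, y}) w (tl w))"

text \<open>The part of an instance that the traveller knows in advance. The set of blocked
  edges is deliberately not a component.\<close>

record 'v ctp_input =
  verts :: "'v set"
  edges :: "'v set set"
  cost :: "'v set \<Rightarrow> real"
  source :: 'v
  target :: 'v
  predicted :: "'v set set"

definition ctp_instance :: "nat \<Rightarrow> 'v ctp_input \<Rightarrow> 'v set set \<Rightarrow> bool" where
  "ctp_instance k I B \<longleftrightarrow>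
     simple_graph (verts I) (edges I) \<and> connected_graph (verts I) (edges I) \<and>
     source I \<in> verts I \<and> target I \<in> verts I \<and>
     (\<forall>e\<in>edges I. 0 \<le> cost I e) \<and>
     B \<subseteq> edges I \<and> card B \<le> k \<and>
     (\<exists>p. is_path (edges I - B) (source I) p (target I)) \<and>
     predicted I \<subseteq> edges I \<and> card (predicted I) \<le> k"

definition OPT :: "'v ctp_input \<Rightarrow> 'v set set \<Rightarrow> real" where
  "OPT I B = Min {walk_cost (cost I) p |p. is_path (edges I - B) (source I) p (target I)}"

text \<open>A deterministic online algorithm chooses the next vertex from the input, the walk made
  so far, and the blocked edges seen so far. An edge with an endpoint on the walk that
  is not among the latter is thereby known to be free. What was known at an earlier
  moment can be recovered from the walk, so no further history is needed.\<close>

type_synonym 'v online_alg = "'v ctp_input \<Rightarrow> 'v list \<Rightarrow> 'v set set \<Rightarrow> 'v"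

definition revealed :: "'v set set \<Rightarrow> 'v list \<Rightarrow> 'v set set" where
  "revealed B w = {e \<in> B. e \<inter> set w \<noteq> {}}"

text \<open>The walk after \<open>n\<close> decisions; the traveller stops on reaching the target.\<close>

primrec run :: "'v online_alg \<Rightarrow> 'v ctp_input \<Rightarrow> 'v set set \<Rightarrow> nat \<Rightarrow> 'v list" where
  "run A I B 0 = [source I]"
| "run A I B (Suc n) =
     (let w = run A I B n
      in if last w = target I then w else w @ [A I w (revealed B w)])"

text \<open>On every instance, whatever the quality of the prediction, the traveller must reach the
  target after finitely many moves, all of them along unblocked edges.\<close>

definition ctp_algorithm :: "nat \<Rightarrow> 'v online_alg \<Rightarrow> bool" where
  "ctp_algorithm k A \<longleftrightarrow>
     (\<forall>I B. ctp_instance k I B \<longrightarrow>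
        (\<exists>n. walk (edges I - B) (source I) (run A I B n) (target I)))"

definition ALG :: "'v online_alg \<Rightarrow> 'v ctp_input \<Rightarrow> 'v set set \<Rightarrow> real" where
  "ALG A I B =
     walk_cost (cost I) (run A I B (LEAST n. last (run A I B n) = target I))"

definition prediction_error :: "'v ctp_input \<Rightarrow> 'v set set \<Rightarrow> nat" where
  "prediction_error I B = card (sym_diff B (predicted I))"

text \<open>The minimum in \<^const>\<open>OPT\<close> is over a finite nonempty set.\<close>

lemma OPT_set_finite_nonempty:
  assumes "ctp_instance k I B"
  shows "finite {walk_cost (cost I) p |p. is_path (edges I - B) (source I) p (target I)}"
    and "{walk_cost (cost I) p |p. is_path (edges I - B) (source I) p (target I)} \<noteq> {}"
proof -
  have I: "finite (verts I)" "source I \<in> verts I" "\<And>e. e \<in> edges I \<Longrightarrow> e \<subseteq> verts I"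
    using assms by (auto simp: ctp_instance_def simple_graph_def)
  have sub: "set w \<subseteq> verts I"
    if "successively (\<lambda>x y. {x, y} \<in> edges I - B) w" "w \<noteq> []" "hd w \<in> verts I" for w
    using that
  proof (induction w)
    case (Cons x w)
    then show ?case using I(3)[of "{x, hd w}"] by (cases w) auto
  qed simp
  have "{p. is_path (edges I - B) (source I) p (target I)} \<subseteq> {p. distinct p \<and> set p \<subseteq> verts I}"
  proof clarify
    fix p assume "is_path (edges I - B) (source I) p (target I)"
    then have p: "successively (\<lambda>x y. {x, y} \<in> edges I - B) p" "p \<noteq> []"
      "hd p = source I" "distinct p"
      by (simp_all add: is_path_def walk_def)
    have "set p \<subseteq> verts I" by (rule sub[OF p(1,2)]) (simp add: p(3) I(2))
    with p(4) show "distinct p \<and> set p \<subseteq> verts I" by simp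
  qed
  moreover have "finite {p. distinct p \<and> set p \<subseteq> verts I}"
    using finite_subset_distinct[OF I(1)] by (simp add: conj_commute)
  ultimately have "finite {p. is_path (edges I - B) (source I) p (target I)}"
    by (rule finite_subset)
  then show "finite {walk_cost (cost I) p |p. is_path (edges I - B) (source I) p (target I)}"
    by simp
  show "{walk_cost (cost I) p |p. is_path (edges I - B) (source I) p (target I)} \<noteq> {}"
    using assms by (auto simp: ctp_instance_def)
qed

end

theory Submission
  imports Defs "HOL-Library.Sublist"
begin

text \<open>The traveller follows a planned path until it turns out to be blocked, walks back to the
  source, and plans again. The plan only depends on the set \<open>R\<close> of blocked edges seen so far.
  Let \<open>\<rho> = (2k + 1) / (2k - 1)\<close> and \<open>i = card R\<close>. As long as \<open>R\<close> lies in the prediction, let \<open>q\<close> be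
  a cheapest path that avoids all predicted edges, and \<open>d\<close> a cheapest path that avoids all but one
  predicted edge outside \<open>R\<close>. The traveller tries \<open>d\<close> if \<open>(2k - 1) c(d) < \<rho>\<^sup>i c(q)\<close> and \<open>q\<close>
  otherwise. With at most one error \<open>c(d) \<le> OPT\<close>, so that failed attempts cost at most \<open>2 i OPT\<close>
  in total; the choice of \<open>\<rho>\<close> also bounds them by \<open>(\<rho>\<^sup>i - 1) c(q)\<close>. If \<open>q\<close> is tried and succeeds,
  the total is at most \<open>\<rho>\<^sup>i c(q)\<close>, and this is at most \<open>(2k - 1) OPT\<close> both if an
  optimal path uses a predicted edge (then \<open>c(d) \<le> OPT\<close> and \<open>q\<close> was preferred to \<open>d\<close>) and if none
  does (then \<open>c(q) \<le> OPT\<close>, and \<open>\<rho>\<^sup>k \<le> 2k - 1\<close>). Once an unpredicted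
  blocked edge is seen, the blocked set is known and the next attempt is optimal.\<close>

section \<open>Walks and their costs\<close>

lemma is_path_mono: "is_path F u p v \<Longrightarrow> F \<subseteq> F' \<Longrightarrow> is_path F' u p v"
  unfolding is_path_def walk_def
  using successively_mono[of "\<lambda>x y. {x, y} \<in> F" p "\<lambda>x y. {x, y} \<in> F'"] by blast

lemma walk_append:
  assumes "walk F u w v" "walk F v q x"
  shows "walk F u (w @ tl q) x"
  using assms by (cases q) (auto simp: walk_def successively_append_iff successively_Cons)

lemma walk_rev: "walk F u w v \<Longrightarrow> walk F v (rev w) u"
  by (auto simp: walk_def hd_rev last_rev insert_commute)

lemma walk_cost_simps [simp]:
  "walk_cost c [] = 0"
  "walk_cost c [x] = 0"
  "walk_cost c (x # y # p) = c {x, y} + walk_cost c (y # p)"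
  by (simp_all add: walk_cost_def)

lemma walk_cost_append:
  "w \<noteq> [] \<Longrightarrow> q \<noteq> [] \<Longrightarrow> last w = hd q \<Longrightarrow>
    walk_cost c (w @ tl q) = walk_cost c w + walk_cost c q"
proof (induction w rule: induct_list012)
  case (2 x)
  then show ?case by (cases q) auto
qed auto

lemma walk_cost_rev: "walk_cost c (rev w) = walk_cost c w"
proof (induction w rule: induct_list012)
  case (3 x y p)
  have "walk_cost c (rev (y # p) @ tl [y, x]) = walk_cost c (rev (y # p)) + walk_cost c [y, x]"
    by (rule walk_cost_append) (auto simp: last_rev)
  with 3 show ?case by (simp add: insert_commute)
qed auto

lemma walk_cost_nonneg:
  "successively (\<lambda>x y. {x, y} \<in> F) w \<Longrightarrow> \<forall>e\<in>F. 0 \<le> c e \<Longrightarrow> 0 \<le> walk_cost c w"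
  by (induction w rule: induct_list012) auto

lemma walk_cost_prefix:
  "successively (\<lambda>x y. {x, y} \<in> F) (q @ r) \<Longrightarrow> \<forall>e\<in>F. 0 \<le> c e \<Longrightarrow>
    walk_cost c q \<le> walk_cost c (q @ r)"
proof (induction q rule: induct_list012)
  case 1
  then show ?case using walk_cost_nonneg[of F r c] by auto
next
  case (2 x)
  then show ?case using walk_cost_nonneg[of F "x # r" c] by auto
qed auto

lemma revealed_mono: "set w \<subseteq> set w' \<Longrightarrow> revealed B w \<subseteq> revealed B w'"
  by (auto simp: revealed_def)

lemma revealed_eq_iff:
  "revealed B w = revealed R w \<longleftrightarrow> (\<forall>v\<in>set w. \<forall>e. v \<in> e \<longrightarrow> (e \<in> B \<longleftrightarrow> e \<in> R))"
  unfolding revealed_def set_eq_iff by blast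

section \<open>Exploring in rounds that return to the source\<close>

text \<open>A blocked edge is noticed at its near endpoint, so the part of a plan that gets walked
  ends there.\<close>

fun advance :: "'v set set \<Rightarrow> 'v list \<Rightarrow> 'v list" where
  "advance B (x # y # p) = (if {x, y} \<in> B then [x] else x # advance B (y # p))"
| "advance B p = p"

lemma advance_eq_Nil [simp]: "advance B p = [] \<longleftrightarrow> p = []"
  by (induction B p rule: advance.induct) auto

lemma hd_advance [simp]: "hd (advance B p) = hd p"
  by (induction B p rule: advance.induct) auto

lemma prefix_advance: "prefix (advance B p) p"
  by (induction B p rule: advance.induct) auto

lemma advance_blocked:
  assumes "advance B p \<noteq> p"
  obtains y r where "p = advance B p @ y # r" "{last (advance B p), y} \<in> B"
  using assms
proof (induction B p arbitrary: thesis rule: advance.induct)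
  case (1 B x y p)
  show ?case
  proof (cases "{x, y} \<in> B")
    case True
    then show ?thesis using 1(2)[of y p] by simp
  next
    case False
    then have "advance B (y # p) \<noteq> y # p" using 1(3) by auto
    from 1(1)[OF False _ this] obtain z r
      where "y # p = advance B (y # p) @ z # r" "{last (advance B (y # p)), z} \<in> B" by blast
    then show ?thesis using False 1(2)[of z r] by simp
  qed
qed auto

lemma successively_advance:
  "successively (\<lambda>x y. {x, y} \<in> F) p \<Longrightarrow> successively (\<lambda>x y. {x, y} \<in> F - B) (advance B p)"
proof (induction B p rule: advance.induct)
  case (1 B x y p)
  then show ?case by (auto simp: successively_Cons)
qed auto

text \<open>Every edge tested by \<open>advance\<close> starts at a vertex that the walk reaches, so
  agreement at those vertices suffices.\<close>

lemma advance_cong: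
  "\<forall>v\<in>set (advance B p). \<forall>e. v \<in> e \<longrightarrow> (e \<in> B \<longleftrightarrow> e \<in> R) \<Longrightarrow> advance R p = advance B p"
proof (induction B p rule: advance.induct)
  case (1 B x y p)
  have x: "{x, y} \<in> B \<longleftrightarrow> {x, y} \<in> R"
    using bspec[OF 1(2), of x] by simp
  show ?case
  proof (cases "{x, y} \<in> B")
    case False
    have "advance R (y # p) = advance B (y # p)"
      by (rule 1(1)[OF False]) (use 1(2) False in simp)
    then show ?thesis using x False by simp
  qed (use x in simp)
qed simp_all

text \<open>The version for a walk still under way: the edge leading to the next vertex is incident
  to the last vertex inspected.\<close>

lemma advance_take_cong:
  "\<forall>v\<in>set (take (Suc m) (advance B p)). \<forall>e. v \<in> e \<longrightarrow> (e \<in> B \<longleftrightarrow> e \<in> R) \<Longrightarrow>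
   Suc m < length (advance B p) \<Longrightarrow> Suc m < length (advance R p)"
proof (induction B p arbitrary: m rule: advance.induct)
  case (1 B x y p)
  have B: "{x, y} \<notin> B"
  proof
    assume "{x, y} \<in> B"
    with 1(3) show False by simp
  qed
  then have R: "{x, y} \<notin> R" using bspec[OF 1(2), of x] by simp
  show ?case
  proof (cases m)
    case 0
    then show ?thesis using R by (simp add: Suc_le_eq)
  next
    case (Suc m')
    have "Suc m' < length (advance R (y # p))"
      by (rule 1(1)[OF B]) (use 1(2,3) B Suc in simp_all)
    then show ?thesis using R Suc by simp
  qed
qed simp_all

text \<open>The outer \<open>tl\<close> drops the vertex where the walk already stands, the inner
  one the turning point.\<close>

definition attempt :: "'v set set \<Rightarrow> 'v list \<Rightarrow> 'v list" where
  "attempt B p = (let q = advance B p in tl q @ (if q = p then [] else tl (rev q)))"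

primrec tour ::
  "('v set set \<Rightarrow> 'v list) \<Rightarrow> 'v \<Rightarrow> 'v \<Rightarrow> 'v set set \<Rightarrow> nat \<Rightarrow> 'v list" where
  "tour f s t B 0 = [s]"
| "tour f s t B (Suc n) =
     (let w = tour f s t B n
      in if last w = t then w else w @ attempt B (f (revealed B w)))"

text \<open>Seen from a walk, the blocked set is only known through its revealed part. Running the tour
  against this part as if it were the whole blocked set predicts the next move correctly, so that
  the tour becomes an online algorithm.\<close>

definition tour_alg :: "('v ctp_input \<Rightarrow> 'v set set \<Rightarrow> 'v list) \<Rightarrow> nat \<Rightarrow> 'v online_alg" where
  "tour_alg f n I w R = tour (f I) (source I) (target I) R n ! length w"

declare tour.simps(2) [simp del]

lemma prefix_tour_Suc: "prefix (tour f s t B n) (tour f s t B (Suc n))"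
  by (simp add: tour.simps(2) Let_def)

lemma last_take_in_butlast: "Suc m < length w \<Longrightarrow> last (take (Suc m) w) \<in> set (butlast w)"
  using nth_mem[of m "butlast w"] by (simp add: take_Suc_conv_app_nth nth_butlast)

section \<open>Outcome of a round and termination\<close>

locale exploration =
  fixes E :: "'v set set" and s t :: 'v and B :: "'v set set"
    and f :: "'v set set \<Rightarrow> 'v list"
  assumes finite_B: "finite B"
    and plan: "R \<subseteq> B \<Longrightarrow> is_path (E - R) s (f R) t"
begin

abbreviation T where "T \<equiv> tour f s t B"
abbreviation known where "known n \<equiv> revealed B (T n)"

lemma known_subset: "known n \<subseteq> B"
  by (auto simp: revealed_def)

lemma plan_known: "is_path (E - known n) s (f (known n)) t"
  by (rule plan[OF known_subset])

lemma plan_nonempty [simp]: "f (known n) \<noteq> []" "hd (f (known n)) = s"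
    "last (f (known n)) = t" "distinct (f (known n))"
  using plan_known[of n] by (auto simp: is_path_def walk_def)

lemma T_nonempty [simp]: "T n \<noteq> []" "hd (T n) = s"
  by (induction n) (auto simp: tour.simps(2) Let_def)

lemma s_in_T [simp]: "s \<in> set (T n)"
  using hd_in_set[OF T_nonempty(1), of n] by simp

lemma T_Suc:
  assumes "last (T n) \<noteq> t"
  shows "T (Suc n) = T n @ attempt B (f (known n))"
  using assms by (simp add: tour.simps(2) Let_def)

lemma advance_walk:
  "walk (E - B) s (advance B (f (known n))) (last (advance B (f (known n))))"
proof -
  have "successively (\<lambda>x y. {x, y} \<in> E) (f (known n))"
    using is_path_mono[OF plan_known[of n] Diff_subset] by (simp add: is_path_def walk_def)
  then show ?thesis
    using successively_advance[of E] plan_nonempty[of n] by (simp add: walk_def)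
qed

lemma attempt_success:
  assumes "last (T n) = s" "last (T n) \<noteq> t" "advance B (f (known n)) = f (known n)"
  shows "T (Suc n) = T n @ tl (f (known n))" "last (T (Suc n)) = t"
    "is_path (E - B) s (f (known n)) t"
    "walk_cost c (T (Suc n)) = walk_cost c (T n) + walk_cost c (f (known n))"
proof -
  let ?p = "f (known n)"
  show *: "T (Suc n) = T n @ tl ?p"
    unfolding T_Suc[OF assms(2)] using assms(3) by (simp add: attempt_def)
  \<comment> \<open>As \<open>s\<close> and \<open>t\<close> differ, the plan has a second vertex,
    and dropping its head keeps its last vertex.\<close>
  obtain y r where "?p = s # y # r"
    using assms plan_nonempty[of n] by (metis last_ConsL list.collapse)
  then show "last (T (Suc n)) = t"
    unfolding * using plan_nonempty(3)[of n] by simp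
  show "is_path (E - B) s ?p t"
    using advance_walk[of n] assms(3) by (simp add: is_path_def)
  show "walk_cost c (T (Suc n)) = walk_cost c (T n) + walk_cost c ?p"
    unfolding * by (rule walk_cost_append) (use assms in auto)
qed

text \<open>The last clause gives progress, as the blocking edge is new. It also locates this edge:
  it lies on the plan, hence in every edge set \<open>F\<close> that supports the plan.\<close>

lemma attempt_failure:
  assumes "last (T n) = s" "last (T n) \<noteq> t" "advance B (f (known n)) \<noteq> f (known n)"
  defines "q \<equiv> advance B (f (known n))"
  shows "T (Suc n) = (T n @ tl q) @ tl (rev q)" "last (T (Suc n)) = s"
    "walk_cost c (T (Suc n)) = walk_cost c (T n) + 2 * walk_cost c q"
    "t \<notin> set q"
    "\<exists>x y. {x, y} \<in> known (Suc n) - known n \<and> {x, y} \<in> E \<and>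
       (\<forall>F. is_path F s (f (known n)) t \<longrightarrow> {x, y} \<in> F)"
proof -
  show *: "T (Suc n) = (T n @ tl q) @ tl (rev q)"
    unfolding T_Suc[OF assms(2)] using assms(3) by (simp add: attempt_def q_def Let_def)
  have q: "q \<noteq> []" "hd q = s" unfolding q_def by auto
  have l: "last (T n @ tl q) = last q"
    using q assms(1) by (cases q) auto
  have "last (rev q) = s" using q by (simp add: last_rev)
  then show "last (T (Suc n)) = s"
    unfolding * using l q
    by (metis hd_Cons_tl hd_rev last_ConsL last_appendR append_Nil2 last.simps rev_is_Nil_conv)
  have "walk_cost c ((T n @ tl q) @ tl (rev q)) = walk_cost c (T n @ tl q) + walk_cost c (rev q)"
    by (rule walk_cost_append) (use q l in \<open>auto simp: hd_rev\<close>)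
  also have "walk_cost c (T n @ tl q) = walk_cost c (T n) + walk_cost c q"
    by (rule walk_cost_append) (use q assms(1) in auto)
  finally show "walk_cost c (T (Suc n)) = walk_cost c (T n) + 2 * walk_cost c q"
    unfolding * by (simp add: walk_cost_rev)
  obtain y r where r: "f (known n) = q @ y # r" and B: "{last q, y} \<in> B"
    using advance_blocked[OF assms(3)] unfolding q_def by metis
  show "t \<notin> set q"
    using plan_nonempty(3,4)[of n] unfolding r by (metis IntI append_is_Nil_conv distinct_append empty_iff last_appendR last_in_set list.distinct(1))
  have edge: "{last q, y} \<in> F" if "is_path F s (f (known n)) t" for F
    using that q unfolding r by (auto simp: is_path_def walk_def successively_append_iff)
  have "last q \<in> set (T n @ tl q)" using l by (metis T_nonempty(1) append_is_Nil_conv last_in_set)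
  then have "{last q, y} \<in> known (Suc n)"
    using B unfolding * by (auto simp: revealed_def)
  \<comment> \<open>The choice \<open>F = E - known n\<close> shows that the edge was not known
    before.\<close>
  then show "\<exists>x y. {x, y} \<in> known (Suc n) - known n \<and> {x, y} \<in> E \<and>
       (\<forall>F. is_path F s (f (known n)) t \<longrightarrow> {x, y} \<in> F)"
    using edge edge[OF plan_known] by blast
qed

lemma known_Suc: "known n \<subseteq> known (Suc n)"
  by (intro revealed_mono set_mono_prefix prefix_tour_Suc)

text \<open>Each failed round reveals a new blocked edge, so \<open>n\<close> failures need
  \<open>n\<close> blocked edges; this yields termination. That \<open>t\<close> occurs only at the
  end matches the stopping rule of \<open>run\<close>.\<close>

lemma T_walk: "walk (E - B) s (T n) (last (T n)) \<and> t \<notin> set (butlast (T n)) \<and>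
  (last (T n) = t \<or> last (T n) = s \<and> n \<le> card (known n))"
proof (induction n)
  case (Suc n)
  show ?case
  proof (cases "last (T n) = t")
    case True
    then have "T (Suc n) = T n" by (simp add: tour.simps(2))
    with Suc True show ?thesis by simp
  next
    case False
    with Suc have s: "last (T n) = s" and w: "walk (E - B) s (T n) s"
      and c: "n \<le> card (known n)" and t: "t \<notin> set (butlast (T n))"
      by auto
    have t': "t \<notin> set (T n)"
      using t False append_butlast_last_id[OF T_nonempty(1), of n]
      by (metis UnE empty_iff list.set(1) set_ConsD set_append)
    show ?thesis
    proof (cases "advance B (f (known n)) = f (known n)")
      case True
      note su = attempt_success[OF s False True]
      have "t \<notin> set (butlast (f (known n)))"
        using plan_nonempty[of n]
        by (metis distinct_butlast not_distinct_conv_prefix append_butlast_last_id distinct_append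
            disjoint_iff list.set_intros(1))
      then have "t \<notin> set (butlast (T n @ tl (f (known n))))"
        using t' by (cases "f (known n)") (auto simp: butlast_append dest: in_set_butlastD split: if_splits)
      moreover have "walk (E - B) s (T n @ tl (f (known n))) t"
        using walk_append[OF w] su(3) by (auto simp: is_path_def)
      ultimately show ?thesis using su by simp
    next
      case F: False
      note fa = attempt_failure[OF s False F]
      let ?q = "advance B (f (known n))"
      have "walk (E - B) s ((T n @ tl ?q) @ tl (rev ?q)) s"
        by (rule walk_append[OF walk_append[OF w advance_walk] walk_rev[OF advance_walk]])
      moreover have "t \<notin> set (T (Suc n))"
        unfolding fa(1) using fa(4) t' by (auto dest: list.set_sel(2)[rotated])
      moreover have "known n \<subset> known (Suc n)"
        using known_Suc fa(5) by blast
      then have "card (known n) < card (known (Suc n))"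
        by (rule psubset_card_mono[OF finite_subset[OF known_subset finite_B]])
      ultimately show ?thesis using fa(1,2) c
        by (auto dest: in_set_butlastD)
    qed
  qed
qed (auto simp: walk_def)

lemma T_reaches_target: "card B < n \<Longrightarrow> last (T n) = t"
  using T_walk[of n] card_mono[OF finite_B known_subset, of n] by linarith

section \<open>The tour depends on revealed edges only\<close>

lemma tour_cong:
  "revealed B (T n) = revealed R (T n) \<Longrightarrow> tour f s t R n = T n"
proof (induction n)
  case (Suc n)
  have sub: "set (T n) \<subseteq> set (T (Suc n))"
    by (intro set_mono_prefix prefix_tour_Suc)
  have agree: "\<forall>v\<in>set (T (Suc n)). \<forall>e. v \<in> e \<longrightarrow> (e \<in> B \<longleftrightarrow> e \<in> R)"
    using Suc(2) unfolding revealed_eq_iff .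
  then have k: "revealed B (T n) = revealed R (T n)"
    using sub unfolding revealed_eq_iff by blast
  note IH = Suc(1)[OF this]
  show ?case
  proof (cases "last (T n) = t")
    case True
    then show ?thesis using IH by (simp add: tour.simps(2))
  next
    case False
    let ?q = "advance B (f (known n))"
    have "set ?q \<subseteq> insert s (set (tl ?q))"
      by (cases ?q) (use hd_advance[of B "f (known n)"] in auto)
    then have "set ?q \<subseteq> set (T (Suc n))"
      using T_Suc[OF False] s_in_T[of n] sub by (auto simp: attempt_def Let_def)
    then have "advance R (f (known n)) = ?q"
      using agree by (intro advance_cong) blast
    then show ?thesis using IH k False by (simp add: tour.simps(2) attempt_def)
  qed
qed (simp only: tour.simps(1))

text \<open>The online property: the next vertex is determined by the blocked edges at the first
  \<open>m\<close> vertices. Nothing further is claimed, since \<open>R\<close> may differ from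
  \<open>B\<close> at that next vertex.\<close>

lemma tour_next:
  assumes "0 < m" "m < length (T n)" "revealed B (take m (T n)) = revealed R (take m (T n))"
  shows "take (Suc m) (tour f s t R n) = take (Suc m) (T n)"
  using assms
proof (induction n)
  case (Suc n)
  have agree: "\<forall>v\<in>set (take m (T (Suc n))). \<forall>e. v \<in> e \<longrightarrow> (e \<in> B \<longleftrightarrow> e \<in> R)"
    using Suc(4) unfolding revealed_eq_iff .
  obtain r where r: "T (Suc n) = T n @ r" using prefix_tour_Suc by (rule prefixE)
  show ?case
  proof (cases "m < length (T n)")
    case True
    then have eq: "take (Suc m) (tour f s t R n) = take (Suc m) (T n)"
      using Suc r by simp
    then have "Suc m \<le> length (tour f s t R n)"
      using True by (metis Suc_leI length_take min.absorb_iff2 min_def)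
    moreover obtain r' where "tour f s t R (Suc n) = tour f s t R n @ r'"
      using prefix_tour_Suc by (rule prefixE)
    ultimately show ?thesis using eq r True by simp
  next
    case False
    \<comment> \<open>All complete rounds are visible here, so \<open>R\<close> leads to the same
      tour so far and to the same next plan.\<close>
    have len: "length (T n) \<le> m" using False by simp
    then have k: "revealed B (T n) = revealed R (T n)"
      using agree unfolding r revealed_eq_iff by auto
    then have IH: "tour f s t R n = T n" by (rule tour_cong)
    have l: "last (T n) \<noteq> t" using Suc(3) len by (auto simp: tour.simps(2))
    define p where "p = f (known n)"
    \<comment> \<open>\<open>x\<close> counts the moves already made in the current round.\<close>
    define x where "x = m - length (T n)"
    have TB: "T (Suc n) = T n @ attempt B p" using T_Suc[OF l] by (simp add: p_def)
    have TR: "tour f s t R (Suc n) = T n @ attempt R p" using IH l k by (simp add: tour.simps(2) Let_def p_def)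
    obtain q where q: "advance B p = s # q"
      by (metis advance_eq_Nil hd_advance list.collapse p_def plan_nonempty(1,2))
    obtain z where "attempt B p = q @ z" using q by (simp add: attempt_def Let_def)
    then have take_m: "take m (T (Suc n)) = T n @ take x (q @ z)"
      using len by (simp add: TB x_def)
    show ?thesis
    proof (cases "length q \<le> x")
      case True
      \<comment> \<open>The whole outward walk is visible, which fixes the round including its
        return.\<close>
      then have "set (advance B p) \<subseteq> set (take m (T (Suc n)))"
        using s_in_T[of n] True unfolding q take_m by auto
      then have "advance R p = advance B p"
        using agree by (intro advance_cong) blast
      then show ?thesis unfolding TB TR by (simp add: attempt_def)
    next
      case F: False
      \<comment> \<open>The outward walk continues: under both sets the next vertex is the next one
        on \<open>p\<close>.\<close>
      have "set (take (Suc x) (advance B p)) \<subseteq> set (take m (T (Suc n)))"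
        using s_in_T[of n] F unfolding q take_m by simp
      then have "\<forall>v\<in>set (take (Suc x) (advance B p)). \<forall>e. v \<in> e \<longrightarrow> (e \<in> B \<longleftrightarrow> e \<in> R)"
        using agree by (meson subsetD)
      then have "Suc x < length (advance R p)"
        by (rule advance_take_cong) (use q F in simp)
      moreover have "Suc x < length (advance B p)" using q F by simp
      moreover have "take (Suc x) (attempt C p) = take (Suc x) (tl p)"
        if l: "Suc x < length (advance C p)" for C
      proof -
        obtain r where "p = advance C p @ r" using prefix_advance by (rule prefixE)
        then have "take (Suc (Suc x)) p = take (Suc (Suc x)) (advance C p)"
          using l by (metis Suc_leI take_all_iff take_append diff_is_0_eq take0 append_Nil2 take_eq_Nil)
        then have "take (Suc x) (tl p) = take (Suc x) (tl (advance C p))"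
          by (simp only: take_tl)
        then show ?thesis using l by (simp add: attempt_def Let_def)
      qed
      ultimately have "take (Suc x) (attempt R p) = take (Suc x) (attempt B p)"
        by simp
      moreover have "Suc m = length (T n) + Suc x" using len by (simp add: x_def)
      ultimately show ?thesis unfolding TB TR by simp
    qed
  qed
qed simp

end

section \<open>The tour as an online algorithm\<close>

text \<open>More than \<open>card B\<close> rounds make the tour complete, and \<open>run\<close>
  then retraces it vertex by vertex. The offset arises because \<open>run\<close> starts with one
  vertex.\<close>

lemma tour_alg_run:
  fixes I :: "'v ctp_input"
  assumes "exploration E (source I) (target I) B (f I)" "card B < n"
  defines "W \<equiv> tour (f I) (source I) (target I) B n"
  shows "run (tour_alg f n) I B m = take (Suc m) W"
proof (induction m)
  case 0
  interpret exploration E "source I" "target I" B "f I" by fact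
  have "W \<noteq> []" "hd W = source I" unfolding W_def by auto
  then show ?case by (cases W) auto
next
  case (Suc m)
  interpret exploration E "source I" "target I" B "f I" by fact
  have W: "W \<noteq> []" "last W = target I" "target I \<notin> set (butlast W)"
    unfolding W_def using T_reaches_target[OF assms(2)] T_walk[of n] by auto
  show ?case
  proof (cases "Suc m < length W")
    case True
    have "last (take (Suc m) W) \<noteq> target I" using W(3) last_take_in_butlast[OF True] by metis
    moreover have "take (Suc (Suc m)) (tour (f I) (source I) (target I)
        (revealed B (take (Suc m) W)) n) = take (Suc (Suc m)) W"
      unfolding W_def
      \<comment> \<open>The hypothesis on \<open>R\<close> holds because \<open>revealed\<close> on
        a fixed walk is idempotent.\<close>
      by (rule tour_next) (use True in \<open>auto simp: W_def revealed_def\<close>)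
    then have "tour (f I) (source I) (target I) (revealed B (take (Suc m) W)) n ! Suc m = W ! Suc m"
      by (metis lessI nth_take)
    ultimately show ?thesis
      using Suc True by (simp add: Let_def tour_alg_def take_Suc_conv_app_nth)
  next
    case False
    then show ?thesis using Suc W by (simp add: Let_def)
  qed
qed

lemma tour_alg_correct:
  fixes I :: "'v ctp_input"
  assumes "exploration E (source I) (target I) B (f I)" "card B < n"
  defines "W \<equiv> tour (f I) (source I) (target I) B n"
  shows "\<exists>m. walk (E - B) (source I) (run (tour_alg f n) I B m) (target I)"
    and "ALG (tour_alg f n) I B = walk_cost (cost I) W"
proof -
  interpret exploration E "source I" "target I" B "f I" by fact
  have W: "W \<noteq> []" "last W = target I" "target I \<notin> set (butlast W)"
    "walk (E - B) (source I) W (target I)"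
    unfolding W_def using T_reaches_target[OF assms(2)] T_walk[of n] by auto
  have run: "run (tour_alg f n) I B m = take (Suc m) W" for m
    unfolding W_def by (rule tour_alg_run) fact+
  have full: "run (tour_alg f n) I B (length W - 1) = W"
    using W(1) by (simp add: run)
  then show "\<exists>m. walk (E - B) (source I) (run (tour_alg f n) I B m) (target I)"
    using W(4) by metis
  define m where "m = (LEAST m. last (run (tour_alg f n) I B m) = target I)"
  have m: "last (take (Suc m) W) = target I"
    using LeastI[of "\<lambda>m. last (run (tour_alg f n) I B m) = target I" "length W - 1"] full W(2)
    unfolding m_def run by simp
  \<comment> \<open>A proper prefix of \<open>W\<close> cannot end in the target, so the least
    stopping time yields all of \<open>W\<close>.\<close>
  have "\<not> Suc m < length W"
    using m W(3) last_take_in_butlast by metis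
  then show "ALG (tour_alg f n) I B = walk_cost (cost I) W"
    using run[of m] by (simp add: ALG_def m_def)
qed

section \<open>The plan and its competitive ratio\<close>

text \<open>Finiteness is asked of the set of values, since \<open>OPT_set_finite_nonempty\<close>
  speaks of the set of costs.\<close>

lemma arg_min_on_finite_image:
  fixes f :: "'a \<Rightarrow> real"
  assumes "finite (f ` S)" "S \<noteq> {}"
  shows "arg_min_on f S \<in> S \<and> (\<forall>y\<in>S. f (arg_min_on f S) \<le> f y)"
proof -
  have "Min (f ` S) \<in> f ` S"
    by (rule Min_in) (simp_all add: assms)
  then obtain x where x: "Min (f ` S) = f x" "x \<in> S" by (rule imageE)
  have "f x \<le> f y" if "y \<in> S" for y
    unfolding x(1)[symmetric] by (rule Min_le[OF assms(1) imageI[OF that]])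
  then have "is_arg_min f (\<lambda>x. x \<in> S) x"
    using x(2) by (simp add: is_arg_min_linorder)
  then have "is_arg_min f (\<lambda>x. x \<in> S) (arg_min_on f S)"
    unfolding arg_min_on_def arg_min_def by (rule someI)
  then show ?thesis
    unfolding is_arg_min_linorder by simp
qed

section \<open>Candidate paths and the choice between them\<close>

definition paths :: "'v ctp_input \<Rightarrow> 'v set set \<Rightarrow> 'v list set" where
  "paths I F = {p. is_path F (source I) p (target I)}"

definition cheapest :: "'v ctp_input \<Rightarrow> 'v list set \<Rightarrow> 'v list" where
  "cheapest I S = arg_min_on (walk_cost (cost I)) S"

text \<open>For \<open>R\<close> inside the prediction this does not depend on \<open>R\<close>.
  Once an unpredicted edge is in \<open>R\<close> and the error is at most 1, the removed edges are
  exactly the blocked ones.\<close>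

definition trusting :: "'v ctp_input \<Rightarrow> 'v set set \<Rightarrow> 'v list set" where
  "trusting I R = paths I (edges I - (predicted I \<union> R))"

text \<open>Here \<open>e\<close> is the guess for a predicted edge that is in fact free. An
  unpredicted edge in \<open>R\<close> uses up the one error, leaving nothing to guess.\<close>

definition doubting :: "'v ctp_input \<Rightarrow> 'v set set \<Rightarrow> 'v list set" where
  "doubting I R =
     (if R \<subseteq> predicted I
      then \<Union>e \<in> predicted I - R. paths I (edges I - (predicted I - {e})) else {})"

definition growth :: "nat \<Rightarrow> real" where
  "growth k = 1 + 2 / (2 * real k - 1)"

text \<open>The last branch arises only for errors above 1; it keeps the plan valid on every
  instance. The tests for emptiness guard against a meaningless \<open>cheapest\<close>.\<close>

definition plan :: "nat \<Rightarrow> 'v ctp_input \<Rightarrow> 'v set set \<Rightarrow> 'v list" where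
  "plan k I R =
     (let d = cheapest I (doubting I R); q = cheapest I (trusting I R)
      in if doubting I R \<noteq> {} \<and>
            (trusting I R = {} \<or> (2 * real k - 1) * walk_cost (cost I) d
                                 < growth k ^ card R * walk_cost (cost I) q)
         then d
         else if trusting I R \<noteq> {} then q
         else cheapest I (paths I (edges I - R)))"

lemma paths_mono: "F \<subseteq> F' \<Longrightarrow> paths I F \<subseteq> paths I F'"
  unfolding paths_def by (intro Collect_mono impI) (rule is_path_mono)

text \<open>By \<open>1 + x \<le> exp x\<close> the power is at most the exponential of
  \<open>(2 * k - 2) / (2 * k - 1)\<close>, hence at most \<open>exp 1\<close>.\<close>

lemma growth_power_le:
  assumes "k \<ge> 1" "i \<le> k - 1"
  shows "growth k ^ i \<le> 3"
proof -
  have "growth k ^ i \<le> growth k ^ (k - 1)"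
    using assms by (intro power_increasing) (auto simp: growth_def)
  also have "\<dots> \<le> exp (2 / (2 * real k - 1)) ^ (k - 1)"
    using assms unfolding growth_def by (intro power_mono exp_ge_add_one_self) auto
  also have "\<dots> = exp (real (k - 1) * (2 / (2 * real k - 1)))"
    by (rule exp_of_nat_mult[symmetric])
  also have "\<dots> \<le> exp 1"
    using assms by (simp add: divide_simps of_nat_diff)
  also have "\<dots> \<le> 3" by (rule exp_le)
  finally show ?thesis .
qed

text \<open>One more factor than before. The bound \<open>5 / 3\<close> is chosen so that three
  times it is 5, the right side at \<open>k = 3\<close>.\<close>

lemma growth_power_le':
  assumes "k \<ge> 3" "i \<le> k"
  shows "growth k ^ i \<le> 2 * real k - 1"
proof -
  have g: "1 \<le> growth k" "growth k \<le> 5 / 3"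
    using assms by (auto simp: growth_def divide_simps)
  have "growth k ^ i \<le> growth k ^ Suc (k - 1)"
    using assms g by (intro power_increasing) auto
  also have "\<dots> = growth k * growth k ^ (k - 1)" by simp
  also have "\<dots> \<le> 5 / 3 * 3"
    using assms g by (intro mult_mono growth_power_le) auto
  also have "\<dots> \<le> 2 * real k - 1" using assms by simp
  finally show ?thesis .
qed

locale ctp =
  fixes k :: nat and I :: "'v ctp_input" and B :: "'v set set"
  assumes inst: "ctp_instance k I B"
begin

lemma finite_edges: "finite (edges I)"
proof (rule finite_subset)
  show "edges I \<subseteq> Pow (verts I)" "finite (Pow (verts I))"
    using inst by (auto simp: ctp_instance_def simple_graph_def)
qed

lemma B_subset: "B \<subseteq> edges I" and predicted_subset: "predicted I \<subseteq> edges I"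
  and card_B: "card B \<le> k" and card_predicted: "card (predicted I) \<le> k"
  and cost_nonneg: "\<forall>e\<in>edges I. 0 \<le> cost I e"
  using inst by (auto simp: ctp_instance_def)

lemma finite_B: "finite B" and finite_predicted: "finite (predicted I)"
  using finite_subset[OF B_subset finite_edges] finite_subset[OF predicted_subset finite_edges]
  by auto

lemma paths_nonempty: "paths I (edges I - B) \<noteq> {}"
  using inst by (auto simp: ctp_instance_def paths_def)

lemma cheapest:
  assumes "S \<subseteq> paths I (edges I)" "S \<noteq> {}"
  shows "cheapest I S \<in> S"
    and "p \<in> S \<Longrightarrow> walk_cost (cost I) (cheapest I S) \<le> walk_cost (cost I) p"
proof -
  \<comment> \<open>With nothing blocked, the finiteness of costs covers all paths of the graph at
    once.\<close>
  have "ctp_instance k I {}"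
    using inst is_path_mono[of "edges I - B" _ _ _ "edges I"] by (auto simp: ctp_instance_def)
  then have "finite (walk_cost (cost I) ` paths I (edges I))"
    using OPT_set_finite_nonempty(1) by (fastforce simp: paths_def image_Collect)
  then have "finite (walk_cost (cost I) ` S)"
    by (rule finite_subset[rotated]) (use assms(1) in blast)
  from arg_min_on_finite_image[OF this assms(2)]
  show "cheapest I S \<in> S" "p \<in> S \<Longrightarrow> walk_cost (cost I) (cheapest I S) \<le> walk_cost (cost I) p"
    by (auto simp: cheapest_def)
qed

lemma OPT_eq: "OPT I B = walk_cost (cost I) (cheapest I (paths I (edges I - B)))"
  unfolding OPT_def
proof (rule Min_eqI)
  show "finite {walk_cost (cost I) p |p. is_path (edges I - B) (source I) p (target I)}"
    by (rule OPT_set_finite_nonempty(1)[OF inst])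
  note c = cheapest[OF paths_mono[OF Diff_subset] paths_nonempty]
  show "walk_cost (cost I) (cheapest I (paths I (edges I - B)))
      \<in> {walk_cost (cost I) p |p. is_path (edges I - B) (source I) p (target I)}"
    using c(1) by (auto simp: paths_def)
  show "walk_cost (cost I) (cheapest I (paths I (edges I - B))) \<le> y"
    if "y \<in> {walk_cost (cost I) p |p. is_path (edges I - B) (source I) p (target I)}" for y
    using c(2) that by (auto simp: paths_def)
qed

lemma path_cost_nonneg: "p \<in> paths I (edges I) \<Longrightarrow> 0 \<le> walk_cost (cost I) p"
  using walk_cost_nonneg[OF _ cost_nonneg] by (auto simp: paths_def is_path_def walk_def)

lemma trusting_subset: "trusting I R \<subseteq> paths I (edges I)"
  unfolding trusting_def by (intro paths_mono) auto

lemma doubting_subset: "doubting I R \<subseteq> paths I (edges I)"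
  unfolding doubting_def using paths_mono[of _ "edges I" I] by auto

text \<open>This holds for every prediction error, as termination is required on all
  instances.\<close>

lemma plan_path:
  assumes "R \<subseteq> B"
  shows "is_path (edges I - R) (source I) (plan k I R) (target I)"
proof -
  have d: "doubting I R \<subseteq> paths I (edges I - R)"
  proof (cases "R \<subseteq> predicted I")
    case True
    have "paths I (edges I - (predicted I - {e})) \<subseteq> paths I (edges I - R)" if "e \<notin> R" for e
      using that True by (intro paths_mono) auto
    then show ?thesis by (auto simp: doubting_def)
  qed (simp add: doubting_def)
  have q: "trusting I R \<subseteq> paths I (edges I - R)"
    unfolding trusting_def by (intro paths_mono) auto
  have r: "paths I (edges I - R) \<noteq> {}"
    using paths_nonempty paths_mono[of "edges I - B" "edges I - R" I] assms by blast
  have "plan k I R \<in> paths I (edges I - R)"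
    using d q cheapest(1)[OF doubting_subset, of R] cheapest(1)[OF trusting_subset, of R]
      cheapest(1)[OF paths_mono[OF Diff_subset] r]
    by (auto simp: plan_def Let_def)
  then show ?thesis by (simp add: paths_def)
qed

sublocale exploration "edges I" "source I" "target I" B "plan k I"
  by unfold_locales (use finite_B plan_path in auto)

end

section \<open>Consequences of a prediction error of at most one\<close>

locale almost_predicted_ctp = ctp +
  assumes k_ge: "k \<ge> 3" and error: "prediction_error I B \<le> 1"
begin

abbreviation c where "c \<equiv> walk_cost (cost I)"
abbreviation opt where "opt \<equiv> OPT I B"
abbreviation trust_cost where "trust_cost \<equiv> c (cheapest I (paths I (edges I - predicted I)))"

lemma error_unique:
  assumes "x \<in> sym_diff B (predicted I)" "y \<in> sym_diff B (predicted I)"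
  shows "x = y"
  using error assms card_le_Suc0_iff_eq[of "sym_diff B (predicted I)"] finite_B finite_predicted
  unfolding prediction_error_def by auto

text \<open>The edge \<open>e\<close> is the only error, so all predicted edges are blocked, and
  \<open>e\<close> takes one of the \<open>k\<close> places in \<open>B\<close>.\<close>

lemma unpredicted:
  assumes "e \<in> B - predicted I"
  shows "B = insert e (predicted I)" "card (predicted I) < k"
proof -
  show *: "B = insert e (predicted I)"
    using error_unique[of e] assms by blast
  show "card (predicted I) < k"
    using card_B assms finite_predicted by (subst (asm) *) auto
qed

lemma opt_path: "cheapest I (paths I (edges I - B)) \<in> paths I (edges I - B)"
  by (rule cheapest(1)[OF paths_mono[OF Diff_subset] paths_nonempty])

lemma opt_nonneg: "0 \<le> opt"
  unfolding OPT_eq using opt_path paths_mono[OF Diff_subset] by (intro path_cost_nonneg) blast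

lemma trust_cost_nonneg: "paths I (edges I - predicted I) \<noteq> {} \<Longrightarrow> 0 \<le> trust_cost"
  using cheapest(1)[of "paths I (edges I - predicted I)"] paths_mono[OF Diff_subset]
  by (intro path_cost_nonneg) blast

lemma trust_cost_le_opt:
  assumes "predicted I \<subseteq> B"
  shows "paths I (edges I - predicted I) \<noteq> {}" "trust_cost \<le> opt"
proof -
  have "paths I (edges I - B) \<subseteq> paths I (edges I - predicted I)"
    using assms by (intro paths_mono) auto
  then have o: "cheapest I (paths I (edges I - B)) \<in> paths I (edges I - predicted I)"
    using opt_path by blast
  then show ne: "paths I (edges I - predicted I) \<noteq> {}" by blast
  show "trust_cost \<le> opt"
    unfolding OPT_eq by (rule cheapest(2)[OF paths_mono[OF Diff_subset] ne o])
qed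

text \<open>Some predicted edge is free and is the only error. All other predicted edges are
  blocked, so an optimal path avoids them.\<close>

lemma doubting_nonempty:
  assumes "\<not> predicted I \<subseteq> B" "R \<subseteq> B" "R \<subseteq> predicted I"
  shows "doubting I R \<noteq> {}" "cheapest I (paths I (edges I - B)) \<in> doubting I R"
proof -
  obtain e where e: "e \<in> predicted I" "e \<notin> B" using assms(1) by blast
  have "predicted I - {e} \<subseteq> B" using e error_unique[of e] by blast
  then have "paths I (edges I - B) \<subseteq> paths I (edges I - (predicted I - {e}))"
    by (intro paths_mono) auto
  then show "cheapest I (paths I (edges I - B)) \<in> doubting I R"
    using opt_path e assms by (auto simp: doubting_def)
  then show "doubting I R \<noteq> {}" by blast
qed

text \<open>An optimal path is always a candidate: if all predicted edges are blocked it avoids them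
  all, so any \<open>e\<close> will do; otherwise \<open>e\<close> is the free one.\<close>

lemma doubt_cost_le_opt:
  assumes "R \<subseteq> B" "doubting I R \<noteq> {}"
  shows "c (cheapest I (doubting I R)) \<le> opt"
proof -
  have R: "R \<subseteq> predicted I" using assms(2) by (auto simp: doubting_def split: if_splits)
  have "cheapest I (paths I (edges I - B)) \<in> doubting I R"
  proof (cases "predicted I \<subseteq> B")
    case True
    obtain e where e: "e \<in> predicted I - R"
      using assms(2) by (auto simp: doubting_def split: if_splits)
    have "paths I (edges I - B) \<subseteq> paths I (edges I - (predicted I - {e}))"
      using True by (intro paths_mono) auto
    then show ?thesis using opt_path e R by (auto simp: doubting_def)
  qed (use doubting_nonempty assms R in blast)
  then show ?thesis
    unfolding OPT_eq by (rule cheapest(2)[OF doubting_subset assms(2)])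
qed

section \<open>The cost invariant over the rounds\<close>

text \<open>The bound for a refuted prediction leaves exactly \<open>opt\<close> for a final optimal
  walk. The clause \<open>source I \<noteq> target I\<close> makes the two cases exclusive, so
  arrival yields the final bound.\<close>

definition invariant :: "nat \<Rightarrow> bool" where
  "invariant n \<longleftrightarrow>
     last (T n) = target I \<and> c (T n) \<le> (2 * real k - 1) * opt \<or>
     last (T n) = source I \<and> source I \<noteq> target I \<and>
     (if known n \<subseteq> predicted I
      then c (T n) \<le> 2 * real (card (known n)) * opt \<and>
           (paths I (edges I - predicted I) \<noteq> {} \<longrightarrow>
              c (T n) \<le> (growth k ^ card (known n) - 1) * trust_cost)
      else c (T n) \<le> (2 * real k - 2) * opt)"

lemma growth_ge_1: "1 \<le> growth k"
  using k_ge by (simp add: growth_def)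

lemma invariant_0: "invariant 0"
  using opt_nonneg trust_cost_nonneg k_ge one_le_power[OF growth_ge_1]
  by (auto simp: invariant_def)

lemma advance_cost: "c (advance B (plan k I (known n))) \<le> c (plan k I (known n))"
proof -
  have "successively (\<lambda>x y. {x, y} \<in> edges I) (plan k I (known n))"
    using is_path_mono[OF plan_known[of n] Diff_subset] by (simp add: is_path_def walk_def)
  moreover obtain r where "plan k I (known n) = advance B (plan k I (known n)) @ r"
    using prefix_advance by (rule prefixE)
  ultimately show ?thesis
    using walk_cost_prefix[OF _ cost_nonneg] by metis
qed

lemma invariant_trust:
  assumes inv: "invariant n" and l: "last (T n) \<noteq> target I" and R: "known n \<subseteq> predicted I"
    and ne: "paths I (edges I - predicted I) \<noteq> {}"
    and p: "plan k I (known n) = cheapest I (paths I (edges I - predicted I))"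
    and d: "doubting I (known n) \<noteq> {} \<Longrightarrow>
      growth k ^ card (known n) * trust_cost \<le> (2 * real k - 1) * c (cheapest I (doubting I (known n)))"
  shows "invariant (Suc n)"
proof -
  let ?i = "card (known n)"
  have s: "last (T n) = source I" and st: "source I \<noteq> target I"
    and c: "c (T n) \<le> (growth k ^ ?i - 1) * trust_cost"
    using inv l R ne by (auto simp: invariant_def)
  have i: "?i \<le> card (predicted I)" by (rule card_mono[OF finite_predicted R])
  show ?thesis
  proof (cases "advance B (plan k I (known n)) = plan k I (known n)")
    case True
    note su = attempt_success[OF s l True]
    have "c (T (Suc n)) \<le> growth k ^ ?i * trust_cost"
      using c su(4)[of "cost I"] p by (simp add: algebra_simps)
    also have "\<dots> \<le> (2 * real k - 1) * opt"
    proof (cases "predicted I \<subseteq> B")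
      case True
      show ?thesis
        using trust_cost_le_opt[OF True] trust_cost_nonneg[OF ne] k_ge i card_predicted
        by (intro mult_mono growth_power_le') auto
    next
      case False
      note dn = doubting_nonempty(1)[OF False known_subset R]
      have "(2 * real k - 1) * c (cheapest I (doubting I (known n))) \<le> (2 * real k - 1) * opt"
        using doubt_cost_le_opt[OF known_subset dn] k_ge by (intro mult_left_mono) auto
      then show ?thesis using d[OF dn] by linarith
    qed
    finally show ?thesis using su(2) by (simp add: invariant_def)
  next
    case False
    note fa = attempt_failure[OF s l False]
    \<comment> \<open>The plan avoids all predicted edges, so the edge that blocks it is
      unpredicted.\<close>
    have "is_path (edges I - predicted I) (source I) (plan k I (known n)) (target I)"
      using cheapest(1)[OF paths_mono[OF Diff_subset] ne] p by (auto simp: paths_def)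
    then obtain e where e: "e \<in> known (Suc n)" "e \<notin> predicted I"
      using fa(5) by blast
    then have "e \<in> B - predicted I" using known_subset by blast
    note u = unpredicted[OF this]
    have "c (T (Suc n)) \<le> (growth k ^ ?i + 1) * trust_cost"
      using c fa(3)[of "cost I"] advance_cost[of n] p by (simp add: algebra_simps)
    \<comment> \<open>The unpredicted edge forces \<open>card (predicted I) < k\<close>, so the
      exponent is at most \<open>k - 1\<close> and the bound 3 applies. Next,
      \<open>4 \<le> 2 * k - 2\<close> uses \<open>k \<ge> 3\<close>.\<close>
    also have "\<dots> \<le> (3 + 1) * opt"
      using trust_cost_le_opt(2) u trust_cost_nonneg[OF ne] k_ge i growth_ge_1
      by (intro mult_mono add_right_mono growth_power_le) auto
    also have "\<dots> \<le> (2 * real k - 2) * opt"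
      using k_ge opt_nonneg by (intro mult_right_mono) auto
    finally show ?thesis using fa(2) st e by (auto simp: invariant_def)
  qed
qed

lemma invariant_doubt:
  assumes inv: "invariant n" and l: "last (T n) \<noteq> target I" and R: "known n \<subseteq> predicted I"
    and dn: "doubting I (known n) \<noteq> {}"
    and p: "plan k I (known n) = cheapest I (doubting I (known n))"
    and d: "paths I (edges I - predicted I) \<noteq> {} \<Longrightarrow>
      (2 * real k - 1) * c (cheapest I (doubting I (known n))) \<le> growth k ^ card (known n) * trust_cost"
  shows "invariant (Suc n)"
proof -
  let ?i = "card (known n)"
  have s: "last (T n) = source I" and st: "source I \<noteq> target I"
    and c: "c (T n) \<le> 2 * real ?i * opt"
    and c': "paths I (edges I - predicted I) \<noteq> {} \<Longrightarrow>
      c (T n) \<le> (growth k ^ ?i - 1) * trust_cost"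
    using inv l R by (auto simp: invariant_def)
  \<comment> \<open>A doubting path needs a predicted edge not yet seen, so fewer than
    \<open>k\<close> blocked edges are known.\<close>
  have "known n \<noteq> predicted I" using dn by (auto simp: doubting_def)
  then have i: "?i < card (predicted I)"
    using R by (intro psubset_card_mono finite_predicted) auto
  have po: "c (plan k I (known n)) \<le> opt"
    unfolding p by (rule doubt_cost_le_opt[OF known_subset dn])
  show ?thesis
  proof (cases "advance B (plan k I (known n)) = plan k I (known n)")
    case True
    note su = attempt_success[OF s l True]
    have "c (T (Suc n)) \<le> (2 * real ?i + 1) * opt"
      using c su(4)[of "cost I"] po by (simp add: algebra_simps)
    also have "\<dots> \<le> (2 * real k - 1) * opt"
      using i card_predicted opt_nonneg by (intro mult_right_mono) auto
    finally show ?thesis using su(2) by (simp add: invariant_def)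
  next
    case False
    note fa = attempt_failure[OF s l False]
    let ?j = "card (known (Suc n))"
    have "known n \<subset> known (Suc n)" using fa(5) known_Suc by blast
    \<comment> \<open>One round may reveal several edges; both bounds are monotone in their
      number.\<close>
    then have j: "Suc ?i \<le> ?j"
      using psubset_card_mono[OF finite_subset[OF known_subset finite_B]] by (simp add: Suc_le_eq)
    have w: "c (T (Suc n)) \<le> c (T n) + 2 * c (plan k I (known n))"
      using fa(3)[of "cost I"] advance_cost[of n] by simp
    have w1: "c (T (Suc n)) \<le> 2 * real (Suc ?i) * opt"
      using w po c by (simp add: algebra_simps)
    show ?thesis
    proof (cases "known (Suc n) \<subseteq> predicted I")
      case True
      have "2 * real (Suc ?i) * opt \<le> 2 * real ?j * opt"
        using j opt_nonneg by (intro mult_right_mono) auto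
      moreover have "c (T (Suc n)) \<le> (growth k ^ ?j - 1) * trust_cost"
        if ne: "paths I (edges I - predicted I) \<noteq> {}"
      proof -
        \<comment> \<open>This explains \<open>growth\<close>: the failure adds at most
          \<open>2 / (2 * k - 1)\<close> times the current power, which turns it into the next
          power.\<close>
        have "2 * c (plan k I (known n)) \<le> growth k ^ ?i * (2 / (2 * real k - 1)) * trust_cost"
          using d[OF ne] k_ge unfolding p by (simp add: field_simps)
        then have "c (T (Suc n)) \<le> (growth k ^ ?i * (1 + 2 / (2 * real k - 1)) - 1) * trust_cost"
          using w c'[OF ne] by (simp add: algebra_simps)
        also have "\<dots> = (growth k ^ Suc ?i - 1) * trust_cost"
          by (simp add: growth_def mult.commute)
        also have "\<dots> \<le> (growth k ^ ?j - 1) * trust_cost"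
          using j trust_cost_nonneg[OF ne] growth_ge_1
          by (intro mult_right_mono diff_right_mono power_increasing) auto
        finally show ?thesis .
      qed
      ultimately show ?thesis using fa(2) st True w1 by (auto simp: invariant_def)
    next
      case F: False
      then obtain e where "e \<in> B - predicted I" using known_subset by blast
      \<comment> \<open>Now \<open>?i < card (predicted I) < k\<close>, so \<open>Suc ?i\<close> is
        at most \<open>k - 1\<close>.\<close>
      from unpredicted(2)[OF this] have "2 * real (Suc ?i) * opt \<le> (2 * real k - 2) * opt"
        using i opt_nonneg by (intro mult_right_mono) auto
      then show ?thesis using fa(2) st F w1 by (auto simp: invariant_def)
    qed
  qed
qed

text \<open>Known and predicted edges together make up \<open>B\<close>, so the plan is an optimal
  path and cannot fail.\<close>

lemma invariant_refuted:
  assumes inv: "invariant n" and l: "last (T n) \<noteq> target I" and R: "\<not> known n \<subseteq> predicted I"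
  shows "invariant (Suc n)"
proof -
  have s: "last (T n) = source I" and c: "c (T n) \<le> (2 * real k - 2) * opt"
    using inv l R by (auto simp: invariant_def)
  obtain e where e: "e \<in> known n" "e \<in> B - predicted I"
    using R known_subset by blast
  then have "predicted I \<union> known n = B"
    using unpredicted(1)[OF e(2)] known_subset[of n] by blast
  then have p: "plan k I (known n) = cheapest I (paths I (edges I - B))"
    using R paths_nonempty by (simp add: plan_def trusting_def doubting_def)
  have "advance B (plan k I (known n)) = plan k I (known n)"
  proof (rule ccontr)
    assume "\<not> ?thesis"
    from attempt_failure(5)[OF s l this] obtain x y
      where "{x, y} \<in> known (Suc n)" "{x, y} \<in> edges I - B"
      using opt_path p by (auto simp: paths_def)
    then show False using known_subset by blast
  qed
  note su = attempt_success[OF s l this]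
  have "c (T (Suc n)) \<le> (2 * real k - 1) * opt"
    using c su(4)[of "cost I"] p OPT_eq by (simp add: algebra_simps)
  then show ?thesis using su(2) by (simp add: invariant_def)
qed

lemma invariant: "invariant n"
proof (induction n)
  case (Suc n)
  show ?case
  proof (cases "last (T n) = target I")
    case True
    then have "T (Suc n) = T n" by (simp add: tour.simps(2))
    then show ?thesis using Suc True by (auto simp: invariant_def)
  next
    case l: False
    show ?thesis
    proof (cases "known n \<subseteq> predicted I")
      case R: True
      have tr: "trusting I (known n) = paths I (edges I - predicted I)"
        using R by (simp add: trusting_def Un_absorb2)
      \<comment> \<open>Whether or not all predicted edges are blocked, an optimal path lies in one
        of the two sets; this excludes the last branch of \<open>plan\<close>.\<close>
      have "trusting I (known n) \<noteq> {} \<or> doubting I (known n) \<noteq> {}"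
        using trust_cost_le_opt(1) doubting_nonempty(1)[OF _ known_subset R] tr by auto
      then consider
        "doubting I (known n) \<noteq> {}"
        "plan k I (known n) = cheapest I (doubting I (known n))"
        "trusting I (known n) = {} \<or> (2 * real k - 1) * c (cheapest I (doubting I (known n)))
           < growth k ^ card (known n) * c (cheapest I (trusting I (known n)))" |
        "trusting I (known n) \<noteq> {}"
        "plan k I (known n) = cheapest I (trusting I (known n))"
        "doubting I (known n) = {} \<or> \<not> (2 * real k - 1) * c (cheapest I (doubting I (known n)))
           < growth k ^ card (known n) * c (cheapest I (trusting I (known n)))"
        unfolding plan_def Let_def by meson
      then show ?thesis
      proof cases
        case 1
        show ?thesis
          by (rule invariant_doubt[OF Suc l R 1(1,2)]) (use 1(3) tr in auto)
      next
        case 2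
        show ?thesis
          by (rule invariant_trust[OF Suc l R]) (use 2 tr in auto)
      qed
    qed (rule invariant_refuted[OF Suc l])
  qed
qed (rule invariant_0)

end

theorem theorem8:
  fixes k :: nat
  assumes "k \<ge> 3"
  shows "\<exists>A :: 'v online_alg. ctp_algorithm k A \<and>
           (\<forall>I B. ctp_instance k I B \<and> prediction_error I B \<le> 1 \<longrightarrow>
              ALG A I B \<le> (2 * real k - 1) * OPT I B)"
proof (intro exI[of _ "tour_alg (plan k) (Suc k)"] conjI allI impI)
  show "ctp_algorithm k (tour_alg (plan k) (Suc k) :: 'v online_alg)"
    unfolding ctp_algorithm_def
  proof (intro allI impI)
    fix I :: "'v ctp_input" and B
    assume "ctp_instance k I B"
    then interpret ctp k I B by unfold_locales
    show "\<exists>n. walk (edges I - B) (source I) (run (tour_alg (plan k) (Suc k)) I B n) (target I)"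
      by (rule tour_alg_correct(1)[where f = "plan k", OF exploration_axioms]) (use card_B in simp)
  qed
next
  fix I :: "'v ctp_input" and B
  assume "ctp_instance k I B \<and> prediction_error I B \<le> 1"
  with assms interpret almost_predicted_ctp k I B by unfold_locales auto
  \<comment> \<open>At most \<open>k\<close> rounds can fail, so \<open>Suc k\<close> rounds always
    suffice.\<close>
  have n: "card B < Suc k" using card_B by simp
  have "c (T (Suc k)) \<le> (2 * real k - 1) * opt"
    using invariant[of "Suc k"] T_reaches_target[OF n] by (auto simp: invariant_def)
  then show "ALG (tour_alg (plan k) (Suc k)) I B \<le> (2 * real k - 1) * OPT I B"
    unfolding tour_alg_correct(2)[where f = "plan k", OF exploration_axioms n] .
qed

end
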